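(* Let $k \geq 2$ be an integer and let $D = D_k(K_2)$ be the order-$k$ Steiner distance hypermatrix of the tree $K_2$ on $n=2$ vertices (a single edge). Then the spectral radius of $D$ is $2^{k-1} - 1$.
   Context: Steiner distance hypermatrix of $K_2$: $D_k(K_2)$ is the order-$k$, dimension-$2$ array indexed by $V(K_2)^k$ whose $(v_1,\ldots,v_k)$ entry is the Steiner distance of $\{v_1,\ldots,v_k\}$, i.e. the least number of edges in a connected subgraph containing these vertices. Thus the entry is $0$ if $v_1=\cdots=v_k$ and $1$ otherwise. Eigenvalues and spectral radius: for a symmetric order-$k$, dimension-$n$ hypermatrix $M=(m_{i_1\cdots i_k})$, the characteristic polynomial is $\det(\lambda I - M)$, where $I$ is the order-$k$ identity hypermatrix (entry $1$ when all indices are equal and $0$ otherwise) and $\det$ is Qi's symmetric hyperdeterminant, i.e. $\det(N)$ is the resultant of the $n$ forms $\sum_{i_2,\ldots,i_k} n_{i i_2\cdots i_k} x_{i_2}\cdots x_{i_k}$, $1\le i\le n$, normalized so that $\det(I)=1$. The eigenvalues of $M$ are the complex roots of the characteristic polynomial; equivalently, the $\lambda\in\mathbb{C}$ for which there is a nonzero $x \in \mathbb{C}^n$ with $\sum_{i_2,\ldots,i_k} m_{i i_2\cdots i_k} x_{i_2}\cdots x_{i_k} = \lambda x_i^{k-1}$ for all $i$. The spectral radius of $M$ is the maximum of $|\lambda|$ over all eigenvalues $\lambda$ of $M$. *)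

theory Defs
  imports Complex_Main "Subresultants.Resultant_Prelim"
begin

section \<open>Graphs and Steiner distance\<close>

text \<open>A simple graph is a pair of a vertex set and a set of edges, each edge being a
  two-element set of vertices.\<close>

type_synonym 'v graph = "'v set \<times> 'v set set"

abbreviation verts :: "'v graph \<Rightarrow> 'v set" where
  "verts G \<equiv> fst G"

abbreviation edges :: "'v graph \<Rightarrow> 'v set set" where
  "edges G \<equiv> snd G"

definition simple_graph :: "'v graph \<Rightarrow> bool" where
  "simple_graph G \<longleftrightarrow> finite (verts G) \<and> (\<forall>e\<in>edges G. e \<subseteq> verts G \<and> card e = 2)"

definition subgraph :: "'v graph \<Rightarrow> 'v graph \<Rightarrow> bool" where
  "subgraph H G \<longleftrightarrow> simple_graph H \<and> verts H \<subseteq> verts G \<and> edges H \<subseteq> edges G"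

definition connected_graph :: "'v graph \<Rightarrow> bool" where
  "connected_graph G \<longleftrightarrow>
     verts G \<noteq> {} \<and> (\<forall>u\<in>verts G. \<forall>v\<in>verts G. (u, v) \<in> {(a, b). {a, b} \<in> edges G}\<^sup>*)"

definition steiner_distance :: "'v graph \<Rightarrow> 'v set \<Rightarrow> nat" where
  "steiner_distance G S =
     (LEAST m. \<exists>H. subgraph H G \<and> connected_graph H \<and> S \<subseteq> verts H \<and> card (edges H) = m)"

definition complete_graph :: "nat \<Rightarrow> nat graph" where
  "complete_graph n = ({..<n}, {e. e \<subseteq> {..<n} \<and> card e = 2})"


section \<open>Hypermatrices\<close>

text \<open>A hypermatrix of order \<open>k\<close> and dimension \<open>n\<close> is a function on the lists of
  length \<open>k\<close> over the index set \<open>{..<n}\<close>; its values on other lists are never used.\<close>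

type_synonym 'a hypermatrix = "nat list \<Rightarrow> 'a"

definition steiner_hypermatrix :: "nat \<Rightarrow> nat graph \<Rightarrow> complex hypermatrix" where
  "steiner_hypermatrix k G =
     (\<lambda>vs. if length vs = k \<and> set vs \<subseteq> verts G then of_nat (steiner_distance G (set vs)) else 0)"

definition identity_hypermatrix :: "'a::zero_neq_one hypermatrix" where
  "identity_hypermatrix = (\<lambda>is. if \<forall>i\<in>set is. \<forall>j\<in>set is. i = j then 1 else 0)"

text \<open>The \<open>i\<close>-th form of a hypermatrix \<open>N\<close>, evaluated at the point \<open>x\<close>.\<close>

definition hyper_form ::
    "nat \<Rightarrow> nat \<Rightarrow> 'a::comm_semiring_1 hypermatrix \<Rightarrow> nat \<Rightarrow> (nat \<Rightarrow> 'a) \<Rightarrow> 'a" where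
  "hyper_form k n N i x =
     (\<Sum>is | length is = k - 1 \<and> set is \<subseteq> {..<n}. N (i # is) * (\<Prod>j\<leftarrow>is. x j))"

text \<open>Dimension two: the form \<open>i\<close> is a binary form of degree \<open>k - 1\<close>. We represent it by
  its dehomogenization, i.e. its value at the point \<open>(X, 1)\<close> over the polynomial ring: the
  coefficient of \<open>X^j\<close> is the coefficient of \<open>x\<^sub>0^j * x\<^sub>1^(k - 1 - j)\<close> in the form.\<close>

definition binary_form_poly :: "nat \<Rightarrow> 'a::comm_ring_1 hypermatrix \<Rightarrow> nat \<Rightarrow> 'a poly" where
  "binary_form_poly k N i =
     hyper_form k 2 (\<lambda>is. [:N is:]) i (\<lambda>j. if j = 0 then [:0, 1:] else 1)"

text \<open>Qi's symmetric hyperdeterminant in dimension two. The resultant of two binary forms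
  of degree \<open>k - 1\<close> is the determinant of their Sylvester matrix of size \<open>2 * (k - 1)\<close>. The
  formal degree \<open>k - 1\<close> is used for both rows, even if the dehomogenizations have smaller
  degree, so the library's \<open>resultant\<close>, which takes actual degrees, would be wrong here.\<close>

definition hyperdet2 :: "nat \<Rightarrow> 'a::comm_ring_1 hypermatrix \<Rightarrow> 'a" where
  "hyperdet2 k N =
     det (sylvester_mat_sub (k - 1) (k - 1) (binary_form_poly k N 0) (binary_form_poly k N 1))"

text \<open>The characteristic polynomial \<open>det (\<lambda> I - M)\<close>: here \<open>[:0, 1:]\<close> is the indeterminate
  \<open>\<lambda>\<close>, and the hyperdeterminant is taken over the ring of polynomials in \<open>\<lambda>\<close>.\<close>

definition hyper_charpoly2 :: "nat \<Rightarrow> 'a::comm_ring_1 hypermatrix \<Rightarrow> 'a poly" where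
  "hyper_charpoly2 k M = hyperdet2 k (\<lambda>is. [:0, 1:] * identity_hypermatrix is - [:M is:])"

definition hyper_eigenvalues2 :: "nat \<Rightarrow> complex hypermatrix \<Rightarrow> complex set" where
  "hyper_eigenvalues2 k M = {z. poly (hyper_charpoly2 k M) z = 0}"

definition hyper_spectral_radius2 :: "nat \<Rightarrow> complex hypermatrix \<Rightarrow> real" where
  "hyper_spectral_radius2 k M = Max (cmod ` hyper_eigenvalues2 k M)"


section \<open>Normalization of the hyperdeterminant\<close>

lemma hyper_form_identity:
  assumes "k \<ge> 2" "i < n"
  shows "hyper_form k n identity_hypermatrix i x = x i ^ (k - 1)"
proof -
  let ?A = "{is. length is = k - 1 \<and> set is \<subseteq> {..<n}}"
  let ?r = "replicate (k - 1) i"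
  have eq: "(\<forall>a\<in>set (i # is). \<forall>b\<in>set (i # is). a = b) \<longleftrightarrow> is = ?r" if "is \<in> ?A" for "is"
    using that replicate_length_same[of "is" i] by auto
  have fin: "finite ?A"
    using finite_lists_length_eq[of "{..<n}" "k - 1"] by (simp add: conj_commute)
  have "hyper_form k n identity_hypermatrix i x
      = (\<Sum>is\<in>?A. if is = ?r then (\<Prod>j\<leftarrow>is. x j) else 0)"
    unfolding hyper_form_def identity_hypermatrix_def
    by (intro sum.cong refl) (simp only: eq if_distrib[of "\<lambda>c. c * _"] mult_1_left mult_zero_left)
  also have "\<dots> = (\<Prod>j\<leftarrow>?r. x j)"
    using fin assms by (simp add: sum.delta)
  also have "\<dots> = x i ^ (k - 1)"
    by (induction "k - 1") (simp_all add: prod_list_replicate)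
  finally show ?thesis .
qed

lemma hyperdet2_identity:
  assumes "k \<ge> 2"
  shows "hyperdet2 k (identity_hypermatrix :: 'a::comm_ring_1 hypermatrix) = 1"
proof -
  have *: "(\<lambda>is. [:identity_hypermatrix is :: 'a:]) = identity_hypermatrix"
    by (auto simp: identity_hypermatrix_def fun_eq_iff one_pCons)
  have p: "binary_form_poly k (identity_hypermatrix :: 'a hypermatrix) 0 = monom 1 (k - 1)"
    using assms by (simp add: binary_form_poly_def * hyper_form_identity monom_altdef)
  have q: "binary_form_poly k (identity_hypermatrix :: 'a hypermatrix) 1 = 1"
    using assms by (simp add: binary_form_poly_def * hyper_form_identity)
  have "sylvester_mat_sub (k - 1) (k - 1) (monom 1 (k - 1)) (1 :: 'a poly)
      = 1\<^sub>m ((k - 1) + (k - 1))"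
    by (intro eq_matI) (auto simp: sylvester_mat_sub_index)
  then show ?thesis
    by (simp add: hyperdet2_def p q[simplified])
qed

end

theory Submission
  imports Defs "Subresultants.Subresultant_Gcd"
    "HOL-Computational_Algebra.Fundamental_Theorem_Algebra"
    "HOL-Computational_Algebra.Field_as_Ring"
begin

text \<open>With \<open>m = k - 1\<close>, the forms of \<open>z I - D\<close> are \<open>(z + 1) x\<^sub>i^m - (x\<^sub>0 + x\<^sub>1)^m\<close>. A common
  zero for \<open>z \<notin> {0, -1}\<close> may be taken to be \<open>(x, 1)\<close>; it satisfies \<open>x^m = 1\<close> and
  \<open>z + 1 = (x + 1)^m\<close>. Subtracting \<open>x^m = 1\<close> from the binomial expansion leaves
  \<open>z = (\<Sum>j<m. (m choose j) x^j)\<close>, a sum of norm at most \<open>2^m - 1\<close>, and \<open>x = 1\<close>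
  attains this bound.\<close>

text \<open>Distributivity: each list records which summand is chosen from each of the
  \<open>m\<close> factors. This evaluates the forms of the all-ones hypermatrix J.\<close>

lemma sum_prod_list_lists_length:
  fixes x :: "'a \<Rightarrow> 'b::comm_semiring_1"
  assumes "finite A"
  shows "(\<Sum>is | length is = m \<and> set is \<subseteq> A. \<Prod>j\<leftarrow>is. x j) = (\<Sum>j\<in>A. x j) ^ m"
proof (induction m)
  case 0
  have "{is. length is = 0 \<and> set is \<subseteq> A} = {[]}" by auto
  then show ?case by simp
next
  case (Suc m)
  let ?L = "\<lambda>m. {is. length is = m \<and> set is \<subseteq> A}"
  have eq: "?L (Suc m) = (\<lambda>(j, is). j # is) ` (A \<times> ?L m)"
    by (auto simp: length_Suc_conv image_iff)
  have inj: "inj_on (\<lambda>(j, is). j # is) (A \<times> ?L m)"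
    by (auto simp: inj_on_def)
  have "(\<Sum>is\<in>?L (Suc m). \<Prod>j\<leftarrow>is. x j) = (\<Sum>(j, is)\<in>A \<times> ?L m. x j * (\<Prod>j\<leftarrow>is. x j))"
    unfolding eq by (subst sum.reindex[OF inj]) (auto intro!: sum.cong)
  also have "\<dots> = (\<Sum>j\<in>A. x j) * (\<Sum>is\<in>?L m. \<Prod>j\<leftarrow>is. x j)"
    by (simp add: sum_product sum.cartesian_product)
  finally show ?case using Suc by simp
qed

lemma steiner_distance_singleton:
  assumes "v \<in> verts G"
  shows "steiner_distance G {v} = 0"
  unfolding steiner_distance_def
proof (rule Least_eq_0, intro exI conjI)
  show "subgraph ({v}, {}) G"
    using assms by (simp add: subgraph_def simple_graph_def)
qed (auto simp: connected_graph_def)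

lemma steiner_distance_edge:
  assumes G: "simple_graph G" and e: "{u, v} \<in> edges G" and "u \<noteq> v"
  shows "steiner_distance G {u, v} = 1"
  unfolding steiner_distance_def
proof (rule Least_equality, intro exI conjI)
  show "subgraph ({u, v}, {{u, v}}) G"
    using assms by (auto simp: subgraph_def simple_graph_def)
  show "connected_graph ({u, v}, {{u, v}})"
    by (auto simp: connected_graph_def insert_commute)
next
  fix m
  assume "\<exists>H. subgraph H G \<and> connected_graph H \<and> {u, v} \<subseteq> verts H \<and> card (edges H) = m"
  then obtain H where H: "simple_graph H" "connected_graph H" "u \<in> verts H" "v \<in> verts H"
      "card (edges H) = m"
    by (auto simp: subgraph_def)
  have "(u, v) \<in> {(a, b). {a, b} \<in> edges H}\<^sup>*"
    using H by (auto simp: connected_graph_def)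
  then have "edges H \<noteq> {}"
    using \<open>u \<noteq> v\<close> by (auto elim: converse_rtranclE)
  \<comment> \<open>\<open>card\<close> is 0 on infinite sets, so a nonempty edge set yields the
    bound only once it is known to be finite.\<close>
  moreover have "finite (edges H)"
    using H(1) by (intro finite_subset[of "edges H" "Pow (verts H)"]) (auto simp: simple_graph_def)
  ultimately show "1 \<le> m"
    using H(5) by (simp add: Suc_le_eq card_gt_0_iff flip: H(5))
qed auto

lemma nonempty_subset_doubleton:
  assumes "A \<subseteq> {a, b}" "A \<noteq> {}"
  shows "A = {a} \<or> A = {b} \<or> A = {a, b}"
  using assms by blast

lemma steiner_hypermatrix_K2:
  assumes "length is = k" "k > 0" "set is \<subseteq> {..<2}"
  shows "steiner_hypermatrix k (complete_graph 2) is = 1 - identity_hypermatrix is"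
proof -
  have G: "simple_graph (complete_graph 2)" "{0, 1} \<in> edges (complete_graph 2)"
    by (auto simp: simple_graph_def complete_graph_def)
  have "set is \<subseteq> {0, 1}" "set is \<noteq> {}"
    using assms by (auto simp: less_2_cases_iff)
  then have "set is = {0} \<or> set is = {1} \<or> set is = {0, 1}"
    by (rule nonempty_subset_doubleton)
  moreover have "(0::nat) < 2" "(1::nat) < 2" by simp_all
  ultimately consider v where "set is = {v}" "v < 2" | "set is = {0, 1}"
    by blast
  then show ?thesis
  proof cases
    case 1
    then show ?thesis
      using assms steiner_distance_singleton[of v "complete_graph 2"]
      by (simp add: steiner_hypermatrix_def identity_hypermatrix_def complete_graph_def)
  next
    case 2
    then show ?thesis
      using assms steiner_distance_edge[OF G]
      by (simp add: steiner_hypermatrix_def identity_hypermatrix_def complete_graph_def)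
  qed
qed

text \<open>Since D = J - I on index lists, \<lambda> I - D = (\<lambda> + 1) I - J: the identity
  contributes a pure power and J a power of the sum of the variables. There are two polynomial
  layers: the scalar \<open>[:1, 1:]\<close> is \<lambda> + 1, while the last
  \<open>[:1, 1:]\<close> is X + 1.\<close>

lemma binary_form_poly_K2:
  fixes k :: nat
  defines "N \<equiv> \<lambda>is. [:0, 1:] * identity_hypermatrix is
                  - [:steiner_hypermatrix k (complete_graph 2) is:]"
  assumes "k \<ge> 2" "i < 2"
  shows "binary_form_poly k N i =
    smult [:1, 1:] ((if i = 0 then [:0, 1:] else 1) ^ (k - 1)) - [:1, 1:] ^ (k - 1)"
proof -
  let ?x = "\<lambda>j::nat. if j = 0 then [:0, 1:] else (1 :: complex poly poly)"
  let ?L = "{is. length is = k - 1 \<and> set is \<subseteq> {..<2::nat}}"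
  have N: "[:N (i # is):] = smult [:1, 1:] (identity_hypermatrix (i # is)) - 1" if "is \<in> ?L" for "is"
  proof -
    have "steiner_hypermatrix k (complete_graph 2) (i # is) = 1 - identity_hypermatrix (i # is)"
      using that assms by (intro steiner_hypermatrix_K2) auto
    then show ?thesis
      by (simp add: N_def identity_hypermatrix_def one_pCons del: pCons_one)
  qed
  have "binary_form_poly k N i =
      (\<Sum>is\<in>?L. smult [:1, 1:] (identity_hypermatrix (i # is) * (\<Prod>j\<leftarrow>is. ?x j)) - (\<Prod>j\<leftarrow>is. ?x j))"
    unfolding binary_form_poly_def hyper_form_def
    by (intro sum.cong refl) (simp only: N left_diff_distrib mult_1_left mult_smult_left)
  also have "\<dots> = smult [:1, 1:] (hyper_form k 2 identity_hypermatrix i ?x)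
      - (\<Sum>is\<in>?L. \<Prod>j\<leftarrow>is. ?x j)"
    unfolding hyper_form_def by (simp add: sum_subtractf smult_sum2)
  also have "\<dots> = smult [:1, 1:] (?x i ^ (k - 1)) - (\<Sum>j<2. ?x j) ^ (k - 1)"
    using assms by (simp add: hyper_form_identity sum_prod_list_lists_length)
  also have "(\<Sum>j<2. ?x j) = [:1, 1:]"
    by (simp add: numeral_2_eq_2 one_pCons del: pCons_one)
  finally show ?thesis .
qed

text \<open>Evaluation at \<lambda> = z is a ring homomorphism, so it commutes with the determinant.
  It acts entrywise on a Sylvester matrix of fixed formal degrees, even where an actual degree
  drops.\<close>

lemma poly_hyper_charpoly2_K2:
  assumes "k \<ge> 2"
  shows "poly (hyper_charpoly2 k (steiner_hypermatrix k (complete_graph 2))) z =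
    det (sylvester_mat_sub (k - 1) (k - 1)
      (smult (z + 1) ([:0, 1:] ^ (k - 1)) - [:1, 1:] ^ (k - 1)) ([:z + 1:] - [:1, 1:] ^ (k - 1)))"
proof -
  interpret h: map_poly_comm_ring_hom "\<lambda>p. poly p z" ..
  have "(0::nat) < 2" "(1::nat) < 2" by simp_all
  note forms = this[THEN binary_form_poly_K2[OF assms]]
  show ?thesis
    unfolding hyper_charpoly2_def hyperdet2_def forms
    by (subst comm_ring_hom.hom_det[OF poly_hom.comm_ring_hom_axioms, symmetric],
        subst sylvester_mat_sub_map) (simp_all add: hom_distribs add.commute)
qed

text \<open>The resultant vanishes exactly when the gcd is nonconstant, and over the complex numbers
  a nonconstant gcd has a root. The condition on \<open>q\<close> keeps the gcd nonzero, so that a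
  linear divisor bounds its degree from below.\<close>

lemma resultant_eq_0_iff_common_root:
  fixes p q :: "complex poly"
  assumes "q \<noteq> 0"
  shows "resultant p q = 0 \<longleftrightarrow> (\<exists>x. poly p x = 0 \<and> poly q x = 0)"
proof
  assume "resultant p q = 0"
  then have "degree (gcd p q) > 0" by (simp add: resultant_0_gcd)
  then obtain x where "poly (gcd p q) x = 0"
    using alg_closed_imp_poly_has_root by blast
  then show "\<exists>x. poly p x = 0 \<and> poly q x = 0"
    by (meson gcd_dvd1 gcd_dvd2 dvd_trans poly_eq_0_iff_dvd)
next
  assume "\<exists>x. poly p x = 0 \<and> poly q x = 0"
  then obtain x where "[:-x, 1:] dvd gcd p q"
    by (auto simp: poly_eq_0_iff_dvd)
  moreover have "gcd p q \<noteq> 0" using assms by simp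
  ultimately have "degree (gcd p q) \<ge> degree [:-x, 1:]"
    by (rule dvd_imp_degree_le)
  then show "resultant p q = 0" by (simp add: resultant_0_gcd)
qed

text \<open>For \<open>z = 0\<close> the first form loses its leading coefficient, so the Sylvester matrix of
  formal degrees is no longer the one of the library's resultant.\<close>

lemma eigenvalue_K2_iff:
  assumes "k \<ge> 2" "z \<noteq> 0"
  shows "z \<in> hyper_eigenvalues2 k (steiner_hypermatrix k (complete_graph 2)) \<longleftrightarrow>
    (\<exists>x. (z + 1) * x ^ (k - 1) = (x + 1) ^ (k - 1) \<and> (x + 1) ^ (k - 1) = z + 1)"
proof -
  define m where "m = k - 1"
  define P where "P = smult (z + 1) ([:0, 1:] ^ m) - [:1, 1:] ^ m"
  define Q where "Q = [:z + 1:] - [:1, 1:] ^ m"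
  have m: "m > 0" using assms by (simp add: m_def)
  have "degree P \<le> m"
    using degree_linear_power[of "0::complex" m] degree_linear_power[of "1::complex" m]
    unfolding P_def by (intro degree_diff_le order.trans[OF degree_smult_le]) simp_all
  \<comment> \<open>Both m-th powers are monic, which leaves (z + 1) - 1.\<close>
  moreover have "coeff P m = z"
    using coeff_linear_power[of "0::complex" m] coeff_linear_power[of "1::complex" m]
    by (simp add: P_def)
  ultimately have "degree P = m"
    using \<open>z \<noteq> 0\<close> by (intro antisym le_degree) auto
  moreover have "degree Q \<le> m"
    using degree_linear_power[of "1::complex" m]
    unfolding Q_def by (intro degree_diff_le) simp_all
  \<comment> \<open>As \<open>m > 0\<close>, the constant \<open>z + 1\<close> does not reach this
    coefficient.\<close>
  moreover have "coeff Q m = -1"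
    using m coeff_linear_power[of "1::complex" m]
    by (simp add: Q_def coeff_pCons split: nat.split)
  ultimately have deg: "degree P = m" "degree Q = m" and "Q \<noteq> 0"
    by (auto intro!: antisym le_degree)
  \<comment> \<open>Actual and formal degrees agree, so the two Sylvester matrices coincide.\<close>
  have "z \<in> hyper_eigenvalues2 k (steiner_hypermatrix k (complete_graph 2)) \<longleftrightarrow> resultant P Q = 0"
    using assms
    by (simp only: hyper_eigenvalues2_def mem_Collect_eq poly_hyper_charpoly2_K2 resultant_def
        sylvester_mat_def deg flip: m_def P_def Q_def)
  also have "\<dots> \<longleftrightarrow> (\<exists>x. poly P x = 0 \<and> poly Q x = 0)"
    using \<open>Q \<noteq> 0\<close> by (rule resultant_eq_0_iff_common_root)
  also have "\<dots> \<longleftrightarrow> (\<exists>x. (z + 1) * x ^ m = (x + 1) ^ m \<and> (x + 1) ^ m = z + 1)"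
    by (intro ex_cong1) (auto simp: P_def Q_def add.commute)
  finally show ?thesis by (simp add: m_def)
qed

lemma norm_eigenvalue_K2_le:
  assumes "k \<ge> 2" and "z \<in> hyper_eigenvalues2 k (steiner_hypermatrix k (complete_graph 2))"
  shows "cmod z \<le> 2 ^ (k - 1) - 1"
proof -
  define m where "m = k - 1"
  have "(2::real) ^ 1 \<le> 2 ^ m"
    using assms by (intro power_increasing) (auto simp: m_def)
  then have two: "(2::real) \<le> 2 ^ m" by simp
  \<comment> \<open>The common-zero criterion requires \<open>z \<noteq> 0\<close>, and cancelling
    \<open>z + 1\<close> requires \<open>z \<noteq> -1\<close>. Both exceptional values have norm at
    most 1, which is within the bound because \<open>2 \<le> 2 ^ m\<close>.\<close>
  consider "z = 0" | "z = -1" | "z \<noteq> 0" "z + 1 \<noteq> 0"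
    by (metis add.commute add_eq_0_iff)
  then have "cmod z \<le> 2 ^ m - 1"
  proof cases
    case 3
    then obtain x where x: "(z + 1) * x ^ m = (x + 1) ^ m" "(x + 1) ^ m = z + 1"
      using assms eigenvalue_K2_iff by (auto simp: m_def)
    with 3 have "x ^ m = 1" by simp
    then have "cmod x = 1"
      using assms power_eq_1_iff[of x m] by (simp add: m_def)
    have atMost: "{..m} = insert m {..<m}" by auto
    have "z = (\<Sum>j\<le>m. of_nat (m choose j) * x ^ j) - x ^ m"
      using x(2) \<open>x ^ m = 1\<close> binomial_ring[of x 1 m] by (simp add: algebra_simps)
    also have "\<dots> = (\<Sum>j<m. of_nat (m choose j) * x ^ j)"
      by (simp add: atMost)
    also have "cmod \<dots> \<le> (\<Sum>j<m. real (m choose j))"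
      by (rule order.trans[OF norm_sum]) (simp add: norm_mult norm_power \<open>cmod x = 1\<close>)
    also have "\<dots> = real (\<Sum>j\<le>m. m choose j) - 1"
      by (simp add: atMost)
    also have "\<dots> = 2 ^ m - 1"
      by (simp add: choose_row_sum)
    finally show ?thesis .
  qed (use two in auto)
  then show ?thesis by (simp add: m_def)
qed

theorem corollary2p3:
  fixes k :: nat and D :: "complex hypermatrix"
  assumes "k \<ge> 2"
    and "D = steiner_hypermatrix k (complete_graph 2)"
  shows "hyper_spectral_radius2 k D = 2 ^ (k - 1) - 1"
proof -
  let ?E = "hyper_eigenvalues2 k D"
  let ?r = "2 ^ (k - 1) - 1 :: complex"
  have le: "cmod z \<le> 2 ^ (k - 1) - 1" if "z \<in> ?E" for z
    using norm_eigenvalue_K2_le that assms by blast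
  have "(2::real) ^ 1 \<le> 2 ^ (k - 1)"
    using assms by (intro power_increasing) auto
  then have pos: "(0::real) < 2 ^ (k - 1) - 1" by simp
  have r: "?r = of_real (2 ^ (k - 1) - 1)" by simp
  have norm_r: "cmod ?r = 2 ^ (k - 1) - 1"
    using pos by (simp only: r norm_of_real abs_of_pos)
  then have "?r \<noteq> 0"
    using pos by (metis norm_zero less_irrefl)
  \<comment> \<open>At x = 1 both equations of the criterion reduce to
    \<open>z + 1 = 2 ^ (k - 1)\<close>.\<close>
  then have "?r \<in> ?E"
    using eigenvalue_K2_iff[of k ?r] assms by (auto intro!: exI[of _ 1])
  moreover have "finite ?E"
  proof -
    \<comment> \<open>\<open>Max\<close> needs a finite set. This point lies beyond the norm bound,
      so it is not a root; hence the characteristic polynomial is nonzero and has finitely many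
      roots.\<close>
    have "complex_of_real (2 ^ (k - 1)) \<notin> ?E"
      using le[of "of_real (2 ^ (k - 1))"] by (auto simp: norm_power)
    then have "hyper_charpoly2 k D \<noteq> 0"
      by (auto simp: hyper_eigenvalues2_def)
    then show ?thesis
      unfolding hyper_eigenvalues2_def by (rule poly_roots_finite)
  qed
  ultimately show ?thesis
    unfolding hyper_spectral_radius2_def using le norm_r
    by (intro Max_eqI) (auto intro: rev_image_eqI)
qed

end
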